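(* Let $n\ge r\ge 2$ be integers and let $k$ be an integer with $k\le r!$. If $k>\left(1-\frac{1}{4(r-1)}\right)r!$, then $f(n,r,k)=n$.
   Context: An $r$-digraph $G$ consists of a finite vertex set $V(G)$ and an edge set $E(G)$ whose elements are ordered lists of $r$ distinct vertices. An $(r,k)$-tournament is an $r$-digraph $G$ such that for every $r$-element set $S\subseteq V(G)$, exactly $k$ of the $r!$ orderings of $S$ are edges of $G$. The tight path $P^{(r)}_s$ is the $r$-digraph with $s$ distinct vertices $v_1,\ldots,v_s$ whose edges are exactly the lists of $r$ consecutive vertices $(v_i,\ldots,v_{i+r-1})$, $1\le i\le s-r+1$ (no edges if $s<r$). An $r$-digraph $G$ contains $P^{(r)}_s$ if there is an injection of its vertices into $V(G)$ mapping edges to edges. $f(n,r,k)$ is the maximum integer $s$ such that every $n$-vertex $(r,k)$-tournament contains a copy of $P^{(r)}_s$; thus $f(n,r,k)=n$ means every $n$-vertex $(r,k)$-tournament has a spanning tight path. *)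

theory Defs
  imports Complex_Main "HOL-Combinatorics.Multiset_Permutations"
begin

record 'a rdigraph =
  verts :: "'a set"
  edges :: "'a list set"

definition is_rdigraph :: "nat \<Rightarrow> 'a rdigraph \<Rightarrow> bool" where
  "is_rdigraph r G \<longleftrightarrow>
     finite (verts G) \<and>
     (\<forall>e\<in>edges G. length e = r \<and> distinct e \<and> set e \<subseteq> verts G)"

definition is_tournament :: "nat \<Rightarrow> nat \<Rightarrow> 'a rdigraph \<Rightarrow> bool" where
  "is_tournament r k G \<longleftrightarrow>
     is_rdigraph r G \<and>
     (\<forall>S. S \<subseteq> verts G \<and> card S = r \<longrightarrow> card (permutations_of_set S \<inter> edges G) = k)"

text \<open>The tight path on \<open>s\<close> vertices, with the vertices numbered from \<open>0\<close>.\<close>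

definition tight_path :: "nat \<Rightarrow> nat \<Rightarrow> nat rdigraph" where
  "tight_path r s = \<lparr>verts = {..<s}, edges = {[i..<i + r] | i. i + r \<le> s}\<rparr>"

definition contains_copy :: "'a rdigraph \<Rightarrow> 'b rdigraph \<Rightarrow> bool" where
  "contains_copy G H \<longleftrightarrow>
     (\<exists>\<phi>. inj_on \<phi> (verts H) \<and> \<phi> ` verts H \<subseteq> verts G \<and> (\<forall>e\<in>edges H. map \<phi> e \<in> edges G))"

text \<open>
  A definition cannot quantify over types, so the tournaments below have natural numbers as
  vertices. This is no restriction: see \<open>tight_path_in_every_tournament\<close>. For
  \<open>k \<le> fact r\<close> the maximum is taken over a finite nonempty set: see
  \<open>finite_path_lengths\<close> and \<open>zero_path_length\<close>.
\<close>

definition path_lengths :: "nat \<Rightarrow> nat \<Rightarrow> nat \<Rightarrow> nat set" where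
  "path_lengths n r k =
     {s. \<forall>G :: nat rdigraph. is_tournament r k G \<and> card (verts G) = n
           \<longrightarrow> contains_copy G (tight_path r s)}"

definition max_tight_path :: "nat \<Rightarrow> nat \<Rightarrow> nat \<Rightarrow> nat" where
  "max_tight_path n r k = Max (path_lengths n r k)"

lemma zero_path_length:
  assumes "r \<ge> 1"
  shows "0 \<in> path_lengths n r k"
  using assms by (auto simp: path_lengths_def contains_copy_def tight_path_def)

lemma exists_tournament:
  assumes "k \<le> fact r"
  shows "\<exists>G :: nat rdigraph. is_tournament r k G \<and> card (verts G) = n"
proof -
  have "\<exists>T. T \<subseteq> permutations_of_set S \<and> card T = k" if "S \<subseteq> {..<n}" "card S = r" for S
  proof -
    have "finite S"
      using that(1) by (rule finite_subset) simp
    then have "k \<le> card (permutations_of_set S)"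
      using assms that(2) by simp
    then show ?thesis
      by (rule obtain_subset_with_card_n) blast
  qed
  then have "\<forall>S. \<exists>T. S \<subseteq> {..<n} \<and> card S = r \<longrightarrow> T \<subseteq> permutations_of_set S \<and> card T = k"
    by blast
  then obtain T where
    T: "\<forall>S. S \<subseteq> {..<n} \<and> card S = r \<longrightarrow> T S \<subseteq> permutations_of_set S \<and> card (T S) = k"
    by (rule choice[THEN exE])
  define G where "G = \<lparr>verts = {..<n}, edges = (\<Union>S\<in>{S. S \<subseteq> {..<n} \<and> card S = r}. T S)\<rparr>"
  have memb: "set e = S \<and> distinct e" if "S \<subseteq> {..<n}" "card S = r" "e \<in> T S" for S e
  proof -
    have "e \<in> permutations_of_set S"
      using T that by blast
    then show ?thesis
      by (simp add: permutations_of_set_def)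
  qed
  have "length e = r \<and> distinct e \<and> set e \<subseteq> {..<n}" if "e \<in> edges G" for e
  proof -
    from that obtain S where S: "S \<subseteq> {..<n}" "card S = r" "e \<in> T S"
      by (auto simp: G_def)
    then show ?thesis
      using memb[OF S] distinct_card[of e] by simp
  qed
  then have "is_rdigraph r G"
    by (simp add: is_rdigraph_def G_def)
  moreover have "permutations_of_set S \<inter> edges G = T S" if S: "S \<subseteq> {..<n}" "card S = r" for S
  proof (intro equalityI subsetI)
    fix e assume "e \<in> permutations_of_set S \<inter> edges G"
    then obtain S' where "set e = S" "S' \<subseteq> {..<n}" "card S' = r" "e \<in> T S'"
      by (auto simp: G_def permutations_of_set_def)
    then show "e \<in> T S"
      using memb by metis
  next
    fix e assume "e \<in> T S"
    then show "e \<in> permutations_of_set S \<inter> edges G"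
      using T S by (auto simp: G_def)
  qed
  ultimately have "is_tournament r k G"
    using T by (simp add: is_tournament_def G_def)
  then show ?thesis
    by (auto simp: G_def)
qed

lemma finite_path_lengths:
  assumes "k \<le> fact r"
  shows "finite (path_lengths n r k)"
proof -
  obtain G :: "nat rdigraph" where G: "is_tournament r k G" "card (verts G) = n"
    using exists_tournament[OF assms] by blast
  have "s \<le> n" if "s \<in> path_lengths n r k" for s
  proof -
    have "contains_copy G (tight_path r s)"
      using that G by (simp add: path_lengths_def)
    then obtain \<phi> :: "nat \<Rightarrow> nat" where "inj_on \<phi> {..<s}" "\<phi> ` {..<s} \<subseteq> verts G"
      unfolding contains_copy_def by (force simp: tight_path_def)
    moreover have "finite (verts G)"
      using G by (simp add: is_tournament_def is_rdigraph_def)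
    ultimately show ?thesis
      using card_inj_on_le[of \<phi> "{..<s}" "verts G"] G by simp
  qed
  then show ?thesis
    by (meson atMost_iff finite_atMost finite_subset subsetI)
qed

lemma tight_path_in_every_tournament:
  fixes G :: "'a rdigraph"
  assumes s: "s \<in> path_lengths n r k" and G: "is_tournament r k G" "card (verts G) = n"
  shows "contains_copy G (tight_path r s)"
proof -
  have fin: "finite (verts G)"
    and E: "\<And>e. e \<in> edges G \<Longrightarrow> length e = r \<and> distinct e \<and> set e \<subseteq> verts G"
    using G by (auto simp: is_tournament_def is_rdigraph_def)
  obtain g where g: "bij_betw g {..<n} (verts G)"
    using ex_bij_betw_nat_finite[OF fin] G(2) by (auto simp: atLeast0LessThan)
  then have inj: "inj_on g {..<n}" and img: "g ` {..<n} = verts G"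
    by (auto simp: bij_betw_def)
  define H where "H = \<lparr>verts = {..<n}, edges = {e. set e \<subseteq> {..<n} \<and> map g e \<in> edges G}\<rparr>"
  have "is_rdigraph r H"
    using E[of "map g _"] by (auto simp: is_rdigraph_def H_def distinct_map)
  moreover have "card (permutations_of_set S \<inter> edges H) = k"
    if S: "S \<subseteq> {..<n}" "card S = r" for S
  proof -
    have injS: "inj_on g S"
      using inj S(1) by (rule inj_on_subset)
    have "map g ` (permutations_of_set S \<inter> edges H) = permutations_of_set (g ` S) \<inter> edges G"
      (is "?L = ?R")
    proof
      show "?L \<subseteq> ?R"
        using injS by (auto simp: H_def permutations_of_set_def distinct_map)
      show "?R \<subseteq> ?L"
      proof
        fix e assume e: "e \<in> ?R"
        then have se: "set e = g ` S" "distinct e" "e \<in> edges G"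
          by (auto simp: permutations_of_set_def)
        define e' where "e' = map (inv_into S g) e"
        have "map g e' = e"
          unfolding e'_def using se(1) by (auto intro!: map_idI simp: f_inv_into_f)
        moreover have "set e' = S"
          unfolding e'_def using se(1) injS by (simp add: image_image)
        moreover have "distinct e'"
          using \<open>map g e' = e\<close> se(2) by (metis distinct_map)
        ultimately show "e \<in> ?L"
          using S(1) se(3) by (intro image_eqI[of _ _ e']) (auto simp: H_def permutations_of_set_def)
      qed
    qed
    moreover have "inj_on (map g) (permutations_of_set S \<inter> edges H)"
    proof (rule inj_onI)
      fix x y
      assume "x \<in> permutations_of_set S \<inter> edges H" "y \<in> permutations_of_set S \<inter> edges H"
        and "map g x = map g y"
      then show "x = y"
        using injS map_inj_on[of g x y] by (simp add: permutations_of_set_def)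
    qed
    moreover have "card (permutations_of_set (g ` S) \<inter> edges G) = k"
    proof -
      have "g ` S \<subseteq> verts G"
        using S(1) img by auto
      moreover have "card (g ` S) = r"
        using S(2) card_image[OF injS] by simp
      ultimately show ?thesis
        using G(1) by (simp add: is_tournament_def)
    qed
    ultimately show ?thesis
      by (metis card_image)
  qed
  ultimately have "is_tournament r k H"
    by (simp add: is_tournament_def H_def)
  then have "contains_copy H (tight_path r s)"
    using s by (auto simp: path_lengths_def H_def)
  then obtain \<phi> where \<phi>: "inj_on \<phi> {..<s}" "\<phi> ` {..<s} \<subseteq> {..<n}"
    "\<forall>e\<in>edges (tight_path r s). map g (map \<phi> e) \<in> edges G"
    by (auto simp: contains_copy_def tight_path_def H_def simp del: map_map)
  have "inj_on (g \<circ> \<phi>) {..<s}"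
    using \<phi>(1,2) inj by (meson comp_inj_on inj_on_subset)
  moreover have "(g \<circ> \<phi>) ` {..<s} \<subseteq> verts G"
    using \<phi>(2) img by auto
  ultimately show ?thesis
    unfolding contains_copy_def using \<phi>(3)
    by (intro exI[of _ "g \<circ> \<phi>"]) (simp add: tight_path_def)
qed

end

theory Submission
  imports Defs
begin

text \<open>
  A uniformly random ordering of the vertices is a tight path with positive probability, by a one-sided
  local lemma. A block of \<open>r\<close> consecutive positions is a non-edge with probability
  \<open>p < 1 / (4 * (r - 1))\<close>, independently of everything outside the block. Going through
  the blocks from left to right, the only earlier blocks that interact with block \<open>i\<close> are the
  \<open>r - 1\<close> preceding ones. If each of these destroys at most a fraction
  \<open>1 / (2 * (r - 1))\<close> of the orderings that are good so far, at least half of the orderings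
  survive them; hence block \<open>i\<close> destroys at most a fraction \<open>2 * p\<close> of the
  survivors, which is again below \<open>1 / (2 * (r - 1))\<close>.
\<close>

text \<open>Fix all entries outside the block: the block then runs through every ordering of one
  \<open>r\<close>-set, at most \<open>q\<close> of them outside \<open>E\<close>, while
  \<open>P\<close> keeps its value since it sees only earlier entries.\<close>

lemma card_bad_block_le:
  fixes V :: "'a set" and E :: "'a list set"
  assumes V: "finite V" and i: "i + r \<le> card V"
    and q: "\<And>S. S \<subseteq> V \<Longrightarrow> card S = r \<Longrightarrow> card (permutations_of_set S - E) \<le> q"
  shows "fact r * card {xs \<in> permutations_of_set V. P (take i xs) \<and> take r (drop i xs) \<notin> E}
    \<le> q * card {xs \<in> permutations_of_set V. P (take i xs)}"
proof -
  define A where "A = {xs \<in> permutations_of_set V. P (take i xs)}"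
  define B where "B = {xs \<in> A. take r (drop i xs) \<notin> E}"
  define f where "f xs = (take i xs, drop (i + r) xs)" for xs :: "'a list"
  have "finite A"
    by (simp add: A_def)
  have "B \<subseteq> A"
    by (auto simp: B_def)
  then have "finite B"
    using \<open>finite A\<close> by (rule finite_subset)
  \<comment> \<open>A fiber of \<open>f\<close> consists of the orderings that differ only inside
    the block.\<close>
  have fiber: "fact r * card {xs \<in> B. f xs = y} \<le> q * card {xs \<in> A. f xs = y}"
    if "y \<in> f ` A" for y
  proof -
    obtain zs where zs: "zs \<in> A" "y = f zs"
      using \<open>y \<in> f ` A\<close> by blast
    define a b c where "a = take i zs" and "b = take r (drop i zs)" and "c = drop (i + r) zs"
    have "zs = a @ b @ c"
      unfolding a_def b_def c_def by (metis add.commute append_take_drop_id drop_drop)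
    have zV: "set zs = V" "distinct zs"
      using zs(1) by (auto simp: A_def permutations_of_set_def)
    then have lz: "length zs = card V"
      by (metis distinct_card)
    have len: "length a = i" "length b = r"
      using i lz by (auto simp: a_def b_def)
    have "P a"
      using zs(1) by (simp add: A_def a_def)
    have abc: "distinct (a @ b @ c)" "set (a @ b @ c) = V"
      using zV \<open>zs = a @ b @ c\<close> by simp_all
    have b: "set b \<subseteq> V" "card (set b) = r"
      using abc len distinct_card[of b] by auto
    define g where "g = (\<lambda>w. a @ w @ c)"
    have inj: "inj_on g X" for X
      by (rule inj_onI) (simp add: g_def)
    have lenw: "length w = r" if "w \<in> permutations_of_set (set b)" for w
      using that b distinct_card[of w] by (auto simp: permutations_of_set_def)
    have FA: "{xs \<in> A. f xs = y} = g ` permutations_of_set (set b)"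
    proof (intro equalityI subsetI)
      fix xs assume xs: "xs \<in> {xs \<in> A. f xs = y}"
      define w where "w = take r (drop i xs)"
      have "take i xs = a" "drop (i + r) xs = c"
        using xs zs(2) by (auto simp: f_def a_def c_def)
      then have "xs = g w"
        unfolding g_def w_def by (metis add.commute append_take_drop_id drop_drop)
      moreover have "distinct xs" "set xs = V"
        using xs by (auto simp: A_def permutations_of_set_def)
      ultimately have "distinct w" "set w = set b"
        using abc by (auto simp: g_def)
      then show "xs \<in> g ` permutations_of_set (set b)"
        using \<open>xs = g w\<close> by (auto simp: permutations_of_set_def)
    next
      fix xs assume "xs \<in> g ` permutations_of_set (set b)"
      then obtain w where w: "w \<in> permutations_of_set (set b)" "xs = g w"
        by blast
      then have "distinct xs" "set xs = V"
        using abc by (auto simp: g_def permutations_of_set_def)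
      moreover have "take i xs = a" "drop (i + r) xs = c"
        using w(2) len lenw[OF w(1)] by (simp_all add: g_def)
      ultimately show "xs \<in> {xs \<in> A. f xs = y}"
        using \<open>P a\<close> zs(2) by (simp add: A_def f_def a_def c_def permutations_of_set_def)
    qed
    have "{xs \<in> B. f xs = y} = {xs \<in> {xs \<in> A. f xs = y}. take r (drop i xs) \<notin> E}"
      by (auto simp: B_def)
    also have "\<dots> = g ` (permutations_of_set (set b) - E)"
      unfolding FA using len lenw by (auto simp: g_def)
    finally have "card {xs \<in> B. f xs = y} \<le> q"
      using q[OF b] by (simp add: card_image[OF inj])
    moreover have "card {xs \<in> A. f xs = y} = fact r"
      unfolding FA card_image[OF inj] using b by simp
    ultimately show ?thesis
      by simp
  qed
  have "fact r * card B = (\<Sum>y\<in>f ` A. fact r * card {xs \<in> B. f xs = y})"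
    using sum.group[OF \<open>finite B\<close> finite_imageI[OF \<open>finite A\<close>, of f], of f "\<lambda>_. 1::nat"]
      \<open>B \<subseteq> A\<close>
    by (simp add: image_mono flip: sum_distrib_left)
  also have "\<dots> \<le> (\<Sum>y\<in>f ` A. q * card {xs \<in> A. f xs = y})"
    by (rule sum_mono) (rule fiber)
  also have "\<dots> = q * card A"
    using sum.group[OF \<open>finite A\<close> finite_imageI[OF \<open>finite A\<close>, of f], of f "\<lambda>_. 1::nat"]
    by (simp flip: sum_distrib_left)
  finally show ?thesis
    by (simp add: A_def B_def)
qed

text \<open>The local lemma in integer form: with p = \<open>q / fact r\<close>, the assumption
  \<open>small\<close> says p \<le> 1 / (4 * (r - 1)), and probabilities become
  cardinalities.\<close>

lemma exists_permutation_blocks_in: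
  fixes V :: "'a set" and E :: "'a list set"
  assumes V: "finite V" "card V = n" and r: "2 \<le> r" "r \<le> n"
    and q: "\<And>S. S \<subseteq> V \<Longrightarrow> card S = r \<Longrightarrow> card (permutations_of_set S - E) \<le> q"
    and small: "4 * (r - 1) * q \<le> fact r"
  shows "\<exists>xs \<in> permutations_of_set V. \<forall>j. j + r \<le> n \<longrightarrow> take r (drop j xs) \<in> E"
proof -
  define N where "N i = {xs \<in> permutations_of_set V. \<forall>j<i. take r (drop j xs) \<in> E}" for i
  \<comment> \<open>These are the orderings whose first block outside \<open>E\<close> starts at
    position \<open>i\<close>.\<close>
  define B where "B i = {xs \<in> N i. take r (drop i xs) \<notin> E}" for i
  have fin: "finite (N i)" for i
    by (simp add: N_def)
  have step: "card (N i) = card (N (Suc i)) + card (B i)" for i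
  proof -
    have "N i = N (Suc i) \<union> B i" "N (Suc i) \<inter> B i = {}"
      by (auto simp: N_def B_def less_Suc_eq)
    then show ?thesis
      using fin[of i] by (metis card_Un_disjoint finite_Un)
  qed
  have anti: "card (N (i + d)) \<le> card (N i)" for i d
    by (rule card_mono[OF fin]) (auto simp: N_def)
  have bad: "2 * (r - 1) * card (B i) \<le> card (N i)" if "i + r \<le> n" for i
    using that
  proof (induction i rule: less_induct)
    case (less i)
    \<comment> \<open>Blocks starting before \<open>l\<close> end before position \<open>i\<close>.
      Truncated subtraction gives \<open>l = 0\<close> when no such block exists.\<close>
    define l where "l = i - (r - 1)"
    \<comment> \<open>Union bound: by induction each block from \<open>l\<close> on destroys at most
      a fraction 1 / (2 * (r - 1)) of \<open>N l\<close>.\<close>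
    have half: "2 * (r - 1) * card (N l) \<le> 2 * (r - 1) * card (N (l + m)) + m * card (N l)"
      if "l + m \<le> i" for m
      using that
    proof (induction m)
      case (Suc m)
      have "2 * (r - 1) * card (B (l + m)) \<le> card (N (l + m))"
        using less.prems Suc.prems by (intro less.IH) auto
      also have "\<dots> \<le> card (N l)"
        by (rule anti)
      finally show ?case
        using Suc step[of "l + m"] by (simp add: algebra_simps)
    qed simp
    have "2 * (r - 1) * card (N l) \<le> 2 * (r - 1) * card (N i) + (i - l) * card (N l)"
      using half[of "i - l"] by (simp add: l_def)
    also have "(i - l) * card (N l) \<le> (r - 1) * card (N l)"
      by (rule mult_right_mono) (auto simp: l_def)
    finally have "(r - 1) * card (N l) \<le> (r - 1) * (2 * card (N i))"
      by simp
    then have Nl: "card (N l) \<le> 2 * card (N i)"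
      using r by (simp only: mult_le_cancel1)
    have earlier: "N l = {xs \<in> permutations_of_set V. \<forall>j<l. take r (drop j (take i xs)) \<in> E}"
    proof -
      have "take r (drop j (take i xs)) = take r (drop j xs)" if "j < l" for j and xs :: "'a list"
        using that by (simp add: l_def drop_take min_def)
      then show ?thesis
        by (auto simp: N_def)
    qed
    \<comment> \<open>Dropping the conditions on the blocks that overlap block \<open>i\<close>
      leaves one that depends only on \<open>take i xs\<close>, as \<open>card_bad_block_le\<close>
      requires.\<close>
    have "B i \<subseteq> {xs \<in> N l. take r (drop i xs) \<notin> E}"
      by (auto simp: B_def N_def l_def)
    then have "card (B i) \<le> card {xs \<in> N l. take r (drop i xs) \<notin> E}"
      using fin by (intro card_mono) auto
    then have "fact r * card (B i) \<le> fact r * card {xs \<in> N l. take r (drop i xs) \<notin> E}"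
      by simp
    also have "\<dots> \<le> q * card (N l)"
      using card_bad_block_le[OF V(1), of i r E q "\<lambda>ys. \<forall>j<l. take r (drop j ys) \<in> E"]
        less.prems V(2) q by (simp add: earlier conj_assoc)
    also have "\<dots> \<le> q * (2 * card (N i))"
      using Nl by simp
    \<comment> \<open>The factor 2 lost in \<open>Nl\<close> and the 2 in the claim make up the 4 in
      \<open>small\<close>.\<close>
    finally have "2 * (r - 1) * (fact r * card (B i)) \<le> 2 * (r - 1) * (q * (2 * card (N i)))"
      by (rule mult_left_mono) simp
    also have "\<dots> = 4 * (r - 1) * q * card (N i)"
      by simp
    also have "\<dots> \<le> fact r * card (N i)"
      using small by (rule mult_right_mono) simp
    finally have "fact r * (2 * (r - 1) * card (B i)) \<le> fact r * card (N i)"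
      by (simp add: ac_simps)
    then show ?case
      by (simp only: mult_le_cancel1) simp
  qed
  have "0 < card (N i)" if "i + r \<le> Suc n" for i
    using that
  proof (induction i)
    case 0
    then show ?case
      using V(1) by (simp add: N_def)
  next
    case (Suc i)
    \<comment> \<open>As \<open>r - 1\<close> is at least 1, each block destroys at most half of the
      survivors, so some remain.\<close>
    have "2 * card (B i) \<le> 2 * (r - 1) * card (B i)"
      using r by (intro mult_right_mono) simp_all
    also have "\<dots> \<le> card (N i)"
      using Suc.prems by (intro bad) simp
    finally show ?case
      using Suc.IH Suc.prems step[of i] by linarith
  qed
  \<comment> \<open>There are \<open>Suc n - r\<close> blocks in all: \<open>j < Suc n - r\<close>
    means \<open>j + r \<le> n\<close>.\<close>
  from this[of "Suc n - r"] obtain xs where "xs \<in> N (Suc n - r)"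
    using r by (fastforce simp: card_gt_0_iff)
  then show ?thesis
    by (intro bexI[of _ xs]) (auto simp: N_def)
qed

lemma contains_tight_path_of_list:
  assumes xs: "distinct xs" "set xs \<subseteq> verts G"
    and blocks: "\<And>j. j + r \<le> length xs \<Longrightarrow> take r (drop j xs) \<in> edges G"
  shows "contains_copy G (tight_path r (length xs))"
proof -
  have "map ((!) xs) [j..<j + r] = take r (drop j xs)" if "j + r \<le> length xs" for j
    using that by (intro nth_equalityI) simp_all
  then show ?thesis
    unfolding contains_copy_def using xs blocks
    by (intro exI[of _ "(!) xs"]) (auto simp: tight_path_def inj_on_def nth_eq_iff_index_eq)
qed

text \<open>The bound \<open>k \<le> fact r\<close> provides a tournament on \<open>n\<close>
  vertices, without which every \<open>s\<close> would qualify vacuously.\<close>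

lemma path_lengths_le:
  assumes "k \<le> fact r" "s \<in> path_lengths n r k"
  shows "s \<le> n"
proof -
  obtain G :: "nat rdigraph" where G: "is_tournament r k G" "card (verts G) = n"
    using exists_tournament[OF assms(1)] by blast
  then obtain \<phi> :: "nat \<Rightarrow> nat" where "inj_on \<phi> {..<s}" "\<phi> ` {..<s} \<subseteq> verts G"
    using assms(2) by (force simp: path_lengths_def contains_copy_def tight_path_def)
  moreover have "finite (verts G)"
    using G by (simp add: is_tournament_def is_rdigraph_def)
  ultimately show ?thesis
    using card_inj_on_le[of \<phi> "{..<s}" "verts G"] G by simp
qed

theorem theorem21:
  fixes n r k :: nat
  assumes "n \<ge> r" and "r \<ge> 2" and "k \<le> fact r"
    and "real k > (1 - 1 / (4 * (real r - 1))) * fact r"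
  shows "max_tight_path n r k = n"
proof -
  \<comment> \<open>This is the number of non-edge orderings of each \<open>r\<close>-set; the
    density hypothesis, cleared of denominators, bounds it.\<close>
  define q where "q = fact r - k"
  have "real (4 * (r - 1) * q) \<le> real (fact r)"
    using assms by (simp add: q_def of_nat_diff field_simps)
  then have small: "4 * (r - 1) * q \<le> fact r"
    by (simp only: of_nat_le_iff)
  have "contains_copy G (tight_path r n)"
    if G: "is_tournament r k G" "card (verts G) = n" for G :: "nat rdigraph"
  proof -
    have fin: "finite (verts G)"
      using G by (simp add: is_tournament_def is_rdigraph_def)
    have "card (permutations_of_set S - edges G) \<le> q" if "S \<subseteq> verts G" "card S = r" for S
    proof -
      have "finite S"
        using that fin finite_subset by blast
      moreover have "card (permutations_of_set S \<inter> edges G) = k"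
        using G that by (simp add: is_tournament_def)
      ultimately show ?thesis
        using that by (simp add: card_Diff_subset_Int q_def)
    qed
    from exists_permutation_blocks_in[OF fin G(2) assms(2,1) this small]
    obtain xs where xs: "xs \<in> permutations_of_set (verts G)"
      "\<forall>j. j + r \<le> n \<longrightarrow> take r (drop j xs) \<in> edges G"
      by blast
    then have "length xs = n"
      using G(2) by (metis distinct_card permutations_of_setD)
    then show ?thesis
      using contains_tight_path_of_list[of xs G r] xs by (simp add: permutations_of_set_def)
  qed
  then have "n \<in> path_lengths n r k"
    by (simp add: path_lengths_def)
  then show ?thesis
    unfolding max_tight_path_def using assms(3)
    by (intro Max_eqI finite_path_lengths) (auto dest: path_lengths_le)
qed

end
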